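(* Let $\mathbb{A}$ be a $k$-letter alphabet, $\pi=(<_D,<_A)$ a pair of distinct total orders on $\mathbb{A}$, $\Omega$ the associated $k\times k$ matrix and $d=\dim\ker(\Omega)$. Let $\mathcal{F}=(v_1,\ldots,v_n)$ be a family consisting of $n$ pairwise non-conjugate primitive words over $\mathbb{A}$. (1) If $\mathcal{F}$ is $\pi$-clustering, then $n\le\lfloor\frac{k+d}{2}\rfloor$. In particular, if $\Omega$ is invertible, in which case $k$ is even, then $n\le k/2$. (2) For $\pi$ symmetric, $\Omega$ is invertible if and only if $k$ is even. (3) If $\mathcal{F}$ is perfectly clustering, then $n\le\lfloor\frac{k+1}{2}\rfloor$.
   Context: $\Omega=(\Omega_{i,j})_{i,j\in\mathbb{A}}$ is the real skew-symmetric matrix with $\Omega_{i,j}=+1$ if $j<_A i$ and $i<_D j$; $\Omega_{i,j}=-1$ if $j<_D i$ and $i<_A j$; $\Omega_{i,j}=0$ otherwise. For nonempty words $w,z$ put $w^\omega=www\cdots$ and $w^{-\omega}=\cdots www$. Write $w<_D z$ if $w^\omega$ is lexicographically smaller than $z^\omega$ with respect to $<_D$ (reading left to right), and $w<_A z$ if $w^{-\omega}$ is reverse-lexicographically smaller than $z^{-\omega}$ with respect to $<_A$ (reading right to left). Two words are conjugate if they are cyclic rotations of one another; a word is primitive if it is not a proper power of another word. A family $\mathcal{F}=(v_1,\ldots,v_n)$ of nonempty words is $\pi$-clustering if for all $1\le i,j\le n$, all conjugates $u$ of $v_i$ and $v$ of $v_j$, one has $u<_A v\Leftrightarrow u<_D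 v$. The pair $\pi$ is symmetric if $a<_D b\Leftrightarrow b<_A a$ for all $a,b\in\mathbb{A}$. $\mathcal{F}$ is perfectly clustering if it is $\pi$-clustering for some symmetric pair of orders $\pi$ on $\mathbb{A}$. *)

theory Defs
  imports "HOL-Analysis.Analysis" "HOL-Library.Stream"
begin

text \<open>Total orders on the alphabet are given by their strict parts, as relations satisfying
  \<^const>\<open>strict_linear_order_on\<close> on the whole type.\<close>

definition lex_less :: "'a rel \<Rightarrow> 'a stream \<Rightarrow> 'a stream \<Rightarrow> bool" where
  "lex_less r s t \<longleftrightarrow> (\<exists>n. (\<forall>m<n. s !! m = t !! m) \<and> (s !! n, t !! n) \<in> r)"

definition less_D :: "'a rel \<Rightarrow> 'a list \<Rightarrow> 'a list \<Rightarrow> bool" where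
  "less_D rD w z \<longleftrightarrow> lex_less rD (cycle w) (cycle z)"

text \<open>The left-infinite word \<open>\<dots>www\<close>, read from right to left, is the right-infinite
  periodic word with period \<open>rev w\<close>. Both comparisons are meaningful for nonempty words only
  (\<open>cycle []\<close> is unspecified).\<close>

definition less_A :: "'a rel \<Rightarrow> 'a list \<Rightarrow> 'a list \<Rightarrow> bool" where
  "less_A rA w z \<longleftrightarrow> lex_less rA (cycle (rev w)) (cycle (rev z))"

definition conjugate :: "'a list \<Rightarrow> 'a list \<Rightarrow> bool" where
  "conjugate u v \<longleftrightarrow> (\<exists>n. v = rotate n u)"

text \<open>The empty word is not primitive, being its own square.\<close>

definition primitive :: "'a list \<Rightarrow> bool" where
  "primitive w \<longleftrightarrow> \<not> (\<exists>u m. 2 \<le> m \<and> w = concat (replicate m u))"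

definition clustering :: "'a rel \<Rightarrow> 'a rel \<Rightarrow> 'a list list \<Rightarrow> bool" where
  "clustering rD rA vs \<longleftrightarrow>
     (\<forall>i<length vs. vs ! i \<noteq> []) \<and>
     (\<forall>i<length vs. \<forall>j<length vs. \<forall>u v.
        conjugate (vs ! i) u \<longrightarrow> conjugate (vs ! j) v \<longrightarrow> (less_A rA u v \<longleftrightarrow> less_D rD u v))"

definition symmetric_pair :: "'a rel \<Rightarrow> 'a rel \<Rightarrow> bool" where
  "symmetric_pair rD rA \<longleftrightarrow> (\<forall>a b. (a, b) \<in> rD \<longleftrightarrow> (b, a) \<in> rA)"

definition perfectly_clustering :: "'a list list \<Rightarrow> bool" where
  "perfectly_clustering vs \<longleftrightarrow>
     (\<exists>rD rA. strict_linear_order rD \<and> strict_linear_order rA \<and>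
        symmetric_pair rD rA \<and> clustering rD rA vs)"

definition Omega :: "'a::finite rel \<Rightarrow> 'a rel \<Rightarrow> real ^ 'a ^ 'a" where
  "Omega rD rA = (\<chi> i j.
     if (j, i) \<in> rA \<and> (i, j) \<in> rD then 1
     else if (j, i) \<in> rD \<and> (i, j) \<in> rA then - 1
     else 0)"

end

theory Submission
  imports Defs
begin

text \<open>
  Let \<open>X\<close> be the set of all rotations of the words of the family, ordered by \<open><\<^sub>D\<close>, and give every
  word of \<open>X\<close> a real weight that is constant on conjugacy classes.  Call the position of \<open>u\<close> the
  total weight of the words below \<open>u\<close>.  Clustering says that \<open><\<^sub>A\<close> induces the same order on
  \<open>X\<close>; hence passing from \<open>u = a u'\<close> to its rotation \<open>u' a\<close> moves the position by a
  translation that depends on the letter \<open>a\<close> only, as in an interval exchange.  The amount is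
  \<open>(\<Omega> \<lambda>)\<^sub>a\<close>, where \<open>\<lambda>\<^sub>b\<close> is the total weight of the words that start with \<open>b\<close>
  (lemma \<open>position_rotate1\<close>).  Two consequences carry the bound.

  The first is isotropy.  Going once around a conjugacy class brings the position back, so the
  translations add up to zero.  Hence the vectors \<open>\<lambda>\<close> of any two invariant weights
  satisfy \<open>\<lambda>'\<^sup>T \<Omega> \<lambda> = 0\<close> (lemma \<open>letter_weight_isotropic\<close>).

  The second is independence.  Suppose that \<open>\<lambda> = 0\<close>.  Then positions do not change under rotation.
  Two neighbours \<open>u < v\<close> in \<open>X\<close> that start with the same letter are rotated to neighbours, so
  after finitely many rotations they start with different letters; at that moment the words below
  the upper one are exactly those with a smaller first letter, and their weight is a sum of
  entries of \<open>\<lambda>\<close>, that is, zero.  So all positions vanish, and therefore so does the weight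
  (lemma \<open>weight_eq_0\<close>).  For pairwise non-conjugate primitive words this shows that the
  \<open>n\<close> vectors \<open>\<lambda>\<close> of the single conjugacy classes, their Parikh vectors, are linearly
  independent.

  An isotropic subspace for \<open>\<Omega>\<close> has dimension at most \<open>(k + d) / 2\<close>.  The remaining claims
  concern \<open>\<Omega>\<close> alone: it is skew-symmetric, so it is singular for odd \<open>k\<close>; and in the symmetric
  case the entries of a vector in its kernel alternate in sign along the alphabet, which gives
  \<open>d \<le> 1\<close>, and \<open>d = 0\<close> for even \<open>k\<close>.
\<close>

section \<open>Lexicographic comparison of periodic words\<close>

lemma lex_less_unfold:
  "lex_less r s t \<longleftrightarrow> (shd s, shd t) \<in> r \<or> shd s = shd t \<and> lex_less r (stl s) (stl t)"
proof
  assume "lex_less r s t"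
  then obtain n where n: "\<forall>m<n. s !! m = t !! m" "(s !! n, t !! n) \<in> r"
    by (auto simp: lex_less_def)
  show "(shd s, shd t) \<in> r \<or> shd s = shd t \<and> lex_less r (stl s) (stl t)"
  proof (cases n)
    case 0
    then show ?thesis using n by simp
  next
    case (Suc k)
    have "shd s = shd t" using n(1) Suc by (metis snth.simps(1) zero_less_Suc)
    moreover have "\<forall>m<k. stl s !! m = stl t !! m"
      using n(1) Suc by (metis Suc_mono snth.simps(2))
    moreover have "(stl s !! k, stl t !! k) \<in> r" using n(2) Suc by simp
    ultimately show ?thesis unfolding lex_less_def by blast
  qed
next
  assume "(shd s, shd t) \<in> r \<or> shd s = shd t \<and> lex_less r (stl s) (stl t)"
  then show "lex_less r s t"
  proof
    assume "(shd s, shd t) \<in> r"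
    then show ?thesis unfolding lex_less_def by (intro exI[of _ 0]) simp
  next
    assume *: "shd s = shd t \<and> lex_less r (stl s) (stl t)"
    then obtain n where n: "\<forall>m<n. stl s !! m = stl t !! m" "(stl s !! n, stl t !! n) \<in> r"
      by (auto simp: lex_less_def)
    have "s !! m = t !! m" if "m < Suc n" for m
      using that n(1) * by (cases m) auto
    then show ?thesis unfolding lex_less_def using n(2) by (intro exI[of _ "Suc n"]) auto
  qed
qed

lemma lex_less_trans:
  assumes "trans r" "lex_less r s t" "lex_less r t u"
  shows "lex_less r s u"
proof -
  obtain m where m: "\<forall>i<m. s !! i = t !! i" "(s !! m, t !! m) \<in> r"
    using assms(2) by (auto simp: lex_less_def)
  obtain n where n: "\<forall>i<n. t !! i = u !! i" "(t !! n, u !! n) \<in> r"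
    using assms(3) by (auto simp: lex_less_def)
  have "(s !! min m n, u !! min m n) \<in> r"
    using m n transD[OF assms(1)] by (cases m n rule: linorder_cases) (auto simp: min_def)
  then show ?thesis
    unfolding lex_less_def using m n by (intro exI[of _ "min m n"]) auto
qed

lemma lex_less_irrefl: "irrefl r \<Longrightarrow> \<not> lex_less r s s"
  by (auto simp: lex_less_def irrefl_def)

lemma lex_less_total:
  assumes "total r" "s \<noteq> t"
  shows "lex_less r s t \<or> lex_less r t s"
proof -
  have ex: "\<exists>i. s !! i \<noteq> t !! i"
    using assms(2) by (metis (no_types) stream_smap_nats stream.map_cong0)
  define n where "n = (LEAST i. s !! i \<noteq> t !! i)"
  have "s !! n \<noteq> t !! n" using LeastI_ex[OF ex] by (simp add: n_def)
  moreover have "\<forall>i<n. s !! i = t !! i" using not_less_Least n_def by blast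
  ultimately show ?thesis
    using assms(1) unfolding lex_less_def total_on_def by (metis UNIV_I)
qed

lemma stl_cycle: "w \<noteq> [] \<Longrightarrow> stl (cycle w) = cycle (rotate1 w)"
  by (simp add: rotate1_hd_tl)

lemma less_D_unfold:
  assumes "w \<noteq> []" "z \<noteq> []"
  shows "less_D r w z \<longleftrightarrow>
    (hd w, hd z) \<in> r \<or> hd w = hd z \<and> less_D r (rotate1 w) (rotate1 z)"
  unfolding less_D_def by (subst lex_less_unfold) (simp add: assms stl_cycle del: cycle.simps(2))

lemma less_A_last:
  assumes "strict_linear_order r" "w \<noteq> []" "z \<noteq> []" "last w \<noteq> last z"
  shows "less_A r w z \<longleftrightarrow> (last w, last z) \<in> r"
  unfolding less_A_def by (subst lex_less_unfold) (simp add: assms hd_rev)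

lemma last_rotate1: "w \<noteq> [] \<Longrightarrow> last (rotate1 w) = hd w"
  by (simp add: rotate1_hd_tl)

lemma strict_linear_order_antisym:
  "strict_linear_order r \<Longrightarrow> (a, b) \<in> r \<Longrightarrow> (b, a) \<notin> r"
  unfolding strict_linear_order_on_def irrefl_def by (meson transD)

lemma strict_linear_order_irrefl: "strict_linear_order r \<Longrightarrow> (a, a) \<notin> r"
  by (simp add: strict_linear_order_on_def irrefl_def)

lemma strict_linear_order_total:
  "strict_linear_order r \<Longrightarrow> a \<noteq> b \<Longrightarrow> (b, a) \<in> r \<longleftrightarrow> (a, b) \<notin> r"
  using strict_linear_order_antisym unfolding strict_linear_order_on_def total_on_def
  by (metis UNIV_I strict_linear_order_on_def)

section \<open>Primitive words\<close>

lemma rotate1_concat_replicate: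
  "rotate1 (concat (replicate m z)) = concat (replicate m (rotate1 z))"
proof (cases z)
  case (Cons a y)
  have "concat (replicate m (a # y)) @ [a] = a # concat (replicate m (y @ [a]))" for m
    by (induction m) auto
  then show ?thesis by (cases m) (auto simp: Cons)
qed simp

text \<open>Rotating a power rotates its root, and rotation is a bijection on words; so a word is a
  proper power as soon as its rotation is one.\<close>

lemma primitive_conjugate:
  assumes "primitive v" "conjugate v u"
  shows "primitive u"
proof -
  have rot: "primitive (rotate1 w)" if "primitive w" for w :: "'a list"
  proof (rule ccontr)
    assume "\<not> primitive (rotate1 w)"
    then obtain z m where m: "2 \<le> m" "rotate1 w = concat (replicate m z)"
      by (auto simp: primitive_def)
    obtain y where "z = rotate1 y" using surj_rotate1 by (meson surjD)
    then have "rotate1 w = rotate1 (concat (replicate m y))"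
      using m(2) by (simp add: rotate1_concat_replicate)
    then have "w = concat (replicate m y)" by (rule injD[OF inj_rotate1])
    then show False using that m(1) by (auto simp: primitive_def)
  qed
  have "primitive (rotate n v)" for n
    by (induction n) (auto simp: assms(1) rot)
  then show ?thesis using assms(2) by (auto simp: conjugate_def)
qed

text \<open>If \<open>w\<^sup>\<omega> = z\<^sup>\<omega>\<close>, then the prefix of length \<open>|w| + |z|\<close> of this word is both \<open>w z\<close> and
  \<open>z w\<close>.  Commuting words are powers of a common word.\<close>

lemma primitive_cycle_inject:
  assumes "primitive w" "primitive z" "cycle w = cycle z"
  shows "w = z"
proof -
  have ne: "w \<noteq> []" "z \<noteq> []"
    using assms(1,2) unfolding primitive_def
    by (metis concat.simps(1) concat_replicate_trivial order_refl)+
  have "w @ z = stake (length w + length z) (cycle w)"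
    using stake_add[of "length w" "cycle w" "length z"] ne assms(3) by (metis sdrop_cycle_eq stake_cycle_eq)
  also have "\<dots> = z @ w"
    using stake_add[of "length z" "cycle z" "length w"] ne assms(3)
    by (metis add.commute sdrop_cycle_eq stake_cycle_eq)
  finally obtain m n y where y: "concat (replicate m y) = w" "concat (replicate n y) = z"
    using comm_append_are_replicate by blast
  have "\<not> 2 \<le> m" "\<not> 2 \<le> n" using assms(1,2) y[symmetric] unfolding primitive_def by blast+
  moreover have "m \<noteq> 0" "n \<noteq> 0" using y ne by auto
  ultimately have "m = 1" "n = 1" by auto
  then show ?thesis using y by simp
qed

section \<open>Weighted positions in a clustering set of rotations\<close>

text \<open>The words are collected in one rotation-closed set \<open>X\<close>, and the members of a family are told
  apart only by weights on \<open>X\<close>.  Then the vectors of several conjugacy classes and their linear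
  combinations are all of the form \<open>letter_weight c\<close>.\<close>

locale clustered_rotations =
  fixes rD rA :: "'a::finite rel" and X :: "'a list set"
  assumes order_D: "strict_linear_order rD"
    and order_A: "strict_linear_order rA"
    and finite_X: "finite X"
    and Nil_notin: "[] \<notin> X"
    and rotate1_X: "rotate1 ` X = X"
    and clustered: "\<And>u v. u \<in> X \<Longrightarrow> v \<in> X \<Longrightarrow> less_A rA u v \<longleftrightarrow> less_D rD u v"
begin

definition letter_weight :: "('a list \<Rightarrow> real) \<Rightarrow> real ^ 'a" where
  "letter_weight c = (\<chi> a. \<Sum>w | w \<in> X \<and> hd w = a. c w)"

definition position :: "('a list \<Rightarrow> real) \<Rightarrow> 'a list \<Rightarrow> real" where
  "position c u = (\<Sum>w | w \<in> X \<and> less_D rD w u. c w)"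

definition invariant :: "('a list \<Rightarrow> real) \<Rightarrow> bool" where
  "invariant c \<longleftrightarrow> (\<forall>w\<in>X. c (rotate1 w) = c w)"

lemma nonempty: "u \<in> X \<Longrightarrow> u \<noteq> []"
  using Nil_notin by auto

lemma rotate1_in: "u \<in> X \<Longrightarrow> rotate1 u \<in> X"
  using rotate1_X by auto

lemma sum_rotate1: "(\<Sum>w\<in>X. f (rotate1 w)) = (\<Sum>w\<in>X. f w)"
  using sum.reindex[OF inj_on_subset[OF inj_rotate1 subset_UNIV], of f X] by (simp add: rotate1_X o_def)

lemma sum_letter_weight:
  "(\<Sum>a\<in>UNIV. f a * letter_weight c $ a) = (\<Sum>w\<in>X. f (hd w) * c w)"
proof -
  have "(\<Sum>a\<in>UNIV. f a * letter_weight c $ a) = (\<Sum>a\<in>UNIV. \<Sum>w | w \<in> X \<and> hd w = a. f (hd w) * c w)"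
    unfolding letter_weight_def by (intro sum.cong) (auto simp: sum_distrib_left)
  also have "\<dots> = (\<Sum>w\<in>X. f (hd w) * c w)"
    by (rule sum.group) (auto simp: finite_X)
  finally show ?thesis .
qed

lemma position_altdef: "position c u = (\<Sum>w\<in>X. of_bool (less_D rD w u) * c w)"
proof -
  have "(\<Sum>w\<in>X. of_bool (less_D rD w u) * c w) = (\<Sum>w\<in>X. if less_D rD w u then c w else 0)"
    by (rule sum.cong) auto
  also have "\<dots> = position c u"
    unfolding position_def by (simp add: sum.If_cases finite_X Int_def)
  finally show ?thesis by simp
qed

text \<open>A word \<open>w\<close> is below \<open>u\<close> if its first letter is smaller, or if the first letters agree and
  the rotation of \<open>w\<close> is below that of \<open>u\<close>.  Read through \<open><\<^sub>A\<close>, the rotation of \<open>w\<close> is below the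
  rotation of \<open>u\<close> if its last letter, the first letter of \<open>w\<close>, is smaller, or if these letters
  agree and again the rotations compare.  The second alternatives are the same, so they cancel.\<close>

lemma position_rotate1:
  assumes "invariant c" "u \<in> X"
  shows "position c (rotate1 u) - position c u = (Omega rD rA *v letter_weight c) $ hd u"
proof -
  have below: "of_bool (less_D rD (rotate1 w) (rotate1 u)) - of_bool (less_D rD w u)
      = Omega rD rA $ hd u $ hd w" (is "?l = ?r") if w: "w \<in> X" for w
  proof (cases "hd w = hd u")
    case True
    show ?thesis
      using True strict_linear_order_irrefl[OF order_D] strict_linear_order_irrefl[OF order_A] less_D_unfold[of w u rD] nonempty w assms(2) by (simp add: Omega_def)
  next
    case False
    have "less_D rD (rotate1 w) (rotate1 u) \<longleftrightarrow> (hd w, hd u) \<in> rA"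
      using clustered[of "rotate1 w" "rotate1 u"] less_A_last[OF order_A, of "rotate1 w" "rotate1 u"]
        False rotate1_in nonempty w assms(2) by (simp add: last_rotate1)
    moreover have "less_D rD w u \<longleftrightarrow> (hd w, hd u) \<in> rD"
      using less_D_unfold[of w u rD] False nonempty w assms(2) by simp
    ultimately show ?thesis
      using strict_linear_order_total[OF order_D False] strict_linear_order_total[OF order_A False]
      by (simp add: Omega_def)
  qed
  have "position c (rotate1 u) = (\<Sum>w\<in>X. of_bool (less_D rD (rotate1 w) (rotate1 u)) * c w)"
    unfolding position_altdef
    by (subst sum_rotate1[symmetric]) (use assms(1) in \<open>simp add: invariant_def\<close>)
  then have "position c (rotate1 u) - position c u = (\<Sum>w\<in>X. Omega rD rA $ hd u $ hd w * c w)"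
    by (simp add: position_altdef below flip: sum_subtractf left_diff_distrib)
  also have "\<dots> = (Omega rD rA *v letter_weight c) $ hd u"
    by (simp add: matrix_vector_mult_def sum_letter_weight)
  finally show ?thesis .
qed

text \<open>By \<open>position_rotate1\<close> the product is the sum over \<open>X\<close> of the weighted increments of the
  position under rotation; rotation permutes \<open>X\<close> and preserves the weight, so the sum
  telescopes.\<close>

lemma letter_weight_isotropic:
  assumes "invariant c" "invariant c'"
  shows "letter_weight c' \<bullet> (Omega rD rA *v letter_weight c) = 0"
proof -
  have "letter_weight c' \<bullet> (Omega rD rA *v letter_weight c)
      = (\<Sum>a\<in>UNIV. (Omega rD rA *v letter_weight c) $ a * letter_weight c' $ a)"
    by (simp add: inner_vec_def mult.commute)
  also have "\<dots> = (\<Sum>u\<in>X. (position c (rotate1 u) - position c u) * c' u)"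
    by (simp only: sum_letter_weight) (use position_rotate1[OF assms(1)] in simp)
  also have "\<dots> = (\<Sum>u\<in>X. position c (rotate1 u) * c' (rotate1 u)) - (\<Sum>u\<in>X. position c u * c' u)"
    using assms(2) by (simp add: invariant_def left_diff_distrib sum_subtractf)
  also have "\<dots> = 0"
    using sum_rotate1[of "\<lambda>u. position c u * c' u"] by simp
  finally show ?thesis .
qed

lemma less_D_trans: "less_D rD u v \<Longrightarrow> less_D rD v w \<Longrightarrow> less_D rD u w"
  using lex_less_trans order_D unfolding less_D_def strict_linear_order_on_def by blast

lemma less_D_irrefl: "\<not> less_D rD u u"
  using lex_less_irrefl order_D unfolding less_D_def strict_linear_order_on_def by blast

definition adjacent :: "'a list \<Rightarrow> 'a list \<Rightarrow> bool" where
  "adjacent u v \<longleftrightarrow> u \<in> X \<and> v \<in> X \<and> less_D rD u v \<and> \<not> (\<exists>x\<in>X. less_D rD u x \<and> less_D rD x v)"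

text \<open>In the order \<open><\<^sub>A\<close> the words of \<open>X\<close> ending in a given letter form an interval, and
  removing this letter from the end and putting it in front preserves the order of this
  interval.\<close>

lemma adjacent_rotate1:
  assumes "adjacent u v" "hd u = hd v"
  shows "adjacent (rotate1 u) (rotate1 v)"
proof -
  have uv: "u \<in> X" "v \<in> X" "less_D rD u v" using assms(1) by (auto simp: adjacent_def)
  have "less_D rD (rotate1 u) (rotate1 v)"
    using less_D_unfold[of u v rD] uv nonempty assms(2)
      strict_linear_order_irrefl[OF order_D] by auto
  moreover have False
    if x: "x \<in> X" "less_D rD (rotate1 u) x" "less_D rD x (rotate1 v)" for x
  proof -
    obtain y where y: "y \<in> X" "x = rotate1 y" using x(1) rotate1_X by auto
    have ne: "u \<noteq> []" "v \<noteq> []" "y \<noteq> []" using uv y nonempty by auto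
    have A: "less_A rA (rotate1 u) (rotate1 y)" "less_A rA (rotate1 y) (rotate1 v)"
      using x y uv clustered rotate1_in by auto
    have "hd y = hd u"
    proof (rule ccontr)
      assume "hd y \<noteq> hd u"
      then have "(hd u, hd y) \<in> rA" "(hd y, hd u) \<in> rA"
        using A less_A_last[OF order_A, of "rotate1 u" "rotate1 y"]
          less_A_last[OF order_A, of "rotate1 y" "rotate1 v"] ne assms(2)
        by (auto simp: last_rotate1)
      then show False using strict_linear_order_antisym[OF order_A] by blast
    qed
    then have "less_D rD u y" "less_D rD y v"
      using less_D_unfold[of u y rD] less_D_unfold[of y v rD] ne x y assms(2) by auto
    then show False using assms(1) y(1) by (auto simp: adjacent_def)
  qed
  ultimately show ?thesis using uv rotate1_in by (auto simp: adjacent_def)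
qed

text \<open>Rotation changes neither the position of \<open>v\<close>, as \<open>letter_weight c = 0\<close>, nor adjacency, as long
  as \<open>u\<close> and \<open>v\<close> start with the same letter.  Once their first letters differ, every word below
  \<open>v\<close> has a smaller first letter: a word below \<open>v\<close> with the first letter of \<open>v\<close> would lie
  strictly between \<open>u\<close> and \<open>v\<close>.\<close>

lemma position_adjacent_eq_0:
  assumes "invariant c" "letter_weight c = 0" "adjacent u v"
  shows "position c v = 0"
proof -
  have uv: "u \<in> X" "v \<in> X" "less_D rD u v" using assms(3) by (auto simp: adjacent_def)
  \<comment> \<open>Induction on the length of the common prefix of the two periodic words.\<close>
  obtain n where "\<forall>m<n. cycle u !! m = cycle v !! m" "(cycle u !! n, cycle v !! n) \<in> rD"
    using uv(3) by (auto simp: less_D_def lex_less_def)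
  then show ?thesis using assms(3) uv(1,2)
  proof (induction n arbitrary: u v)
    case 0
    then have lt: "(hd u, hd v) \<in> rD" by simp
    have "less_D rD w v \<longleftrightarrow> (hd w, hd v) \<in> rD" if w: "w \<in> X" for w
    proof -
      have "\<not> less_D rD w v" if "hd w = hd v"
        using 0 w lt less_D_unfold[of u w rD] nonempty that by (auto simp: adjacent_def)
      moreover have "(hd v, hd v) \<notin> rD"
        by (rule strict_linear_order_irrefl[OF order_D])
      ultimately show ?thesis
        using less_D_unfold[of w v rD] 0 w nonempty by auto
    qed
    then have "position c v = (\<Sum>w\<in>X. of_bool ((hd w, hd v) \<in> rD) * c w)"
      unfolding position_altdef by (intro sum.cong) auto
    also have "\<dots> = (\<Sum>a\<in>UNIV. of_bool ((a, hd v) \<in> rD) * letter_weight c $ a)"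
      by (simp only: sum_letter_weight)
    finally show ?case using assms(2) by simp
  next
    case (Suc n)
    have ne: "u \<noteq> []" "v \<noteq> []" using Suc.prems nonempty by auto
    have hd: "hd u = hd v" using Suc.prems(1) by (metis cycle.simps(1) snth.simps(1) zero_less_Suc)
    have step: "cycle (rotate1 w) !! m = cycle w !! Suc m" if "w \<noteq> []" for w :: "'a list" and m
      using stl_cycle[OF that] by (metis snth.simps(2))
    have "position c (rotate1 v) = 0"
    proof (rule Suc.IH)
      show "\<forall>m<n. cycle (rotate1 u) !! m = cycle (rotate1 v) !! m"
        "(cycle (rotate1 u) !! n, cycle (rotate1 v) !! n) \<in> rD"
        using Suc.prems(1,2) by (auto simp only: step[OF ne(1)] step[OF ne(2)])
    qed (use Suc.prems hd adjacent_rotate1 rotate1_in in auto)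
    then show ?case
      using position_rotate1[OF assms(1) Suc.prems(5)] assms(2) by simp
  qed
qed

text \<open>All positions vanish by \<open>position_adjacent_eq_0\<close>.  Then the largest word with nonzero weight cannot
  exist: its weight would be the total weight minus its position, and the total weight is the
  sum of the entries of \<open>letter_weight c\<close>.\<close>

lemma weight_eq_0:
  assumes "invariant c" "letter_weight c = 0" "inj_on cycle X" "w \<in> X"
  shows "c w = 0"
proof -
  have transp: "transp_on Y (less_D rD)" for Y
    using less_D_trans by (auto simp: transp_on_def)
  have asymp: "asymp_on Y (less_D rD)" for Y
    using less_D_trans less_D_irrefl by (auto simp: asymp_on_def)
  have total: "totalp_on Y (less_D rD)" if "Y \<subseteq> X" for Y
    unfolding totalp_on_def less_D_def
    using lex_less_total order_D inj_onD[OF assms(3)] that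
    unfolding strict_linear_order_on_def by (metis subsetD)
  have pos: "position c v = 0" if v: "v \<in> X" for v
  proof (cases "{u \<in> X. less_D rD u v} = {}")
    case True
    then show ?thesis unfolding position_def by (simp only: sum.empty)
  next
    case False
    let ?Y = "{u \<in> X. less_D rD u v}"
    obtain u where u: "u \<in> ?Y" "\<forall>x\<in>?Y. x \<noteq> u \<longrightarrow> \<not> less_D rD u x"
      using Finite_Set.bex_max_element[OF _ asymp transp False] finite_X by auto
    then have "adjacent u v"
      using v less_D_irrefl by (auto simp: adjacent_def)
    then show ?thesis using position_adjacent_eq_0 assms(1,2) by blast
  qed
  let ?Z = "{u \<in> X. c u \<noteq> 0}"
  have "?Z = {}"
  proof (rule ccontr)
    assume ne: "?Z \<noteq> {}"
    obtain u where u: "u \<in> ?Z" "\<forall>x\<in>?Z. x \<noteq> u \<longrightarrow> \<not> less_D rD u x"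
      using Finite_Set.bex_max_element[OF _ asymp transp ne] finite_X by auto
    have "c x = of_bool (less_D rD x u) * c x + (if x = u then c u else 0)" if "x \<in> X" for x
      using u that total[of X] less_D_irrefl unfolding totalp_on_def by (cases "x = u") auto
    then have "(\<Sum>x\<in>X. c x) = (\<Sum>x\<in>X. of_bool (less_D rD x u) * c x + (if x = u then c u else 0))"
      by (rule sum.cong[OF refl])
    also have "\<dots> = position c u + c u"
      using u(1) finite_X by (simp add: sum.distrib position_altdef)
    finally have "(\<Sum>x\<in>X. c x) = c u" using pos u(1) by simp
    moreover have "(\<Sum>x\<in>X. c x) = 0"
      using sum_letter_weight[of "\<lambda>_. 1" c] assms(2) by simp
    ultimately show False using u(1) by simp
  qed
  then show ?thesis using assms(4) by auto
qed

end

section \<open>Isotropic subspaces\<close>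

text \<open>A complement of \<open>ker M\<close> inside \<open>V\<close> is mapped injectively by \<open>M\<close> into the orthogonal
  complement of \<open>V\<close>.\<close>

lemma dim_isotropic_le:
  fixes M :: "real ^ 'n ^ 'n" and V :: "(real ^ 'n) set"
  assumes "subspace V" "\<And>x y. x \<in> V \<Longrightarrow> y \<in> V \<Longrightarrow> x \<bullet> (M *v y) = 0"
  shows "2 * dim V \<le> CARD('n) + dim {x. M *v x = 0}"
proof -
  let ?K = "{x. M *v x = 0}"
  have K: "subspace ?K"
    by (auto simp: subspace_def matrix_vector_right_distrib matrix_vector_mult_scaleR)
  define U where "U = {y \<in> V. \<forall>x \<in> V \<inter> ?K. orthogonal x y}"
  have U: "subspace U"
    unfolding U_def using assms(1) by (auto simp: subspace_def orthogonal_def inner_simps)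
  have dU: "dim U + dim (V \<inter> ?K) = dim V"
    unfolding U_def using assms(1) K
    by (intro dim_subspace_orthogonal_to_vectors) (auto intro: subspace_inter)
  have "inj_on ((*v) M) U"
  proof (rule inj_onI)
    fix x y assume xy: "x \<in> U" "y \<in> U" "M *v x = M *v y"
    then have "x - y \<in> U" using U by (simp add: subspace_diff)
    moreover have "M *v (x - y) = 0" using xy(3) by (simp add: matrix_vector_mult_diff_distrib)
    ultimately have "orthogonal (x - y) (x - y)" unfolding U_def by blast
    then show "x = y" by (simp add: orthogonal_self)
  qed
  then have "dim ((*v) M ` U) = dim U"
    using dim_image_eq[of "(*v) M" U] U by (metis matrix_vector_mul_linear span_eq_iff)
  moreover have "dim (V \<union> (*v) M ` U) = dim V + dim ((*v) M ` U)"
    by (rule dim_orthogonal_sum) (use assms(2) in \<open>auto simp: U_def\<close>)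
  moreover have "dim (V \<union> (*v) M ` U) \<le> CARD('n)"
    by (metis dim_subset_UNIV DIM_cart DIM_real mult.right_neutral)
  moreover have "dim (V \<inter> ?K) \<le> dim ?K" by (intro dim_subset) auto
  ultimately show ?thesis using dU by linarith
qed

lemma isotropic_family_card_le:
  fixes M :: "real ^ 'n ^ 'n" and f :: "nat \<Rightarrow> real ^ 'n"
  assumes "\<And>i j. i < m \<Longrightarrow> j < m \<Longrightarrow> f i \<bullet> (M *v f j) = 0"
    and indep: "\<And>c i. (\<Sum>i<m. c i *\<^sub>R f i) = 0 \<Longrightarrow> i < m \<Longrightarrow> c i = (0::real)"
  shows "2 * m \<le> CARD('n) + dim {x. M *v x = 0}"
proof -
  have inj: "inj_on f {..<m}"
  proof (rule inj_onI, rule ccontr)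
    fix i j assume ij: "i \<in> {..<m}" "j \<in> {..<m}" "f i = f j" "i \<noteq> j"
    \<comment> \<open>The relation \<open>f i - f j = 0\<close>.\<close>
    let ?c = "\<lambda>l. if l = i then 1 else if l = j then -1 else 0 :: real"
    have "(\<Sum>l<m. ?c l *\<^sub>R f l) = (\<Sum>l\<in>{i, j}. ?c l *\<^sub>R f l)"
      by (rule sum.mono_neutral_right) (use ij in auto)
    also have "\<dots> = 0" using ij by simp
    finally have "?c i = 0" by (rule indep) (use ij in auto)
    then show False by simp
  qed
  have "independent (f ` {..<m})"
  proof (subst independent_explicit, intro conjI allI impI ballI)
    fix c v assume c: "(\<Sum>v\<in>f ` {..<m}. c v *\<^sub>R v) = 0" and v: "v \<in> f ` {..<m}"
    have "(\<Sum>i<m. c (f i) *\<^sub>R f i) = 0" using c inj by (simp add: sum.reindex)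
    then show "c v = 0" using indep[of "\<lambda>i. c (f i)"] v by auto
  qed auto
  then have "dim (span (f ` {..<m})) = m"
    using inj by (simp add: dim_eq_card_independent card_image)
  moreover have "x \<bullet> (M *v y) = 0" if "x \<in> span (f ` {..<m})" "y \<in> span (f ` {..<m})" for x y
  proof -
    have "subspace {x. x \<bullet> (M *v f j) = 0}" for j
      by (auto simp: subspace_def inner_simps)
    then have 1: "x \<bullet> (M *v f j) = 0" if "j < m" for j
      using span_induct[OF \<open>x \<in> _\<close>, of "\<lambda>x. x \<bullet> (M *v f j) = 0"] that assms(1) by auto
    have "subspace {y. x \<bullet> (M *v y) = 0}"
      by (auto simp: subspace_def inner_simps matrix_vector_right_distrib matrix_vector_mult_scaleR)
    then show ?thesis
      using span_induct[OF \<open>y \<in> _\<close>, of "\<lambda>y. x \<bullet> (M *v y) = 0"] 1 by auto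
  qed
  ultimately show ?thesis using dim_isotropic_le[of "span (f ` {..<m})" M] by simp
qed

section \<open>The bound for clustering families\<close>

lemma conjugate_refl: "conjugate v v"
  unfolding conjugate_def by (rule exI[of _ 0]) simp

lemma conjugate_trans: "conjugate u v \<Longrightarrow> conjugate v w \<Longrightarrow> conjugate u w"
  unfolding conjugate_def by (metis rotate_rotate)

lemma conjugate_rotate1: "conjugate v (rotate1 v)"
  unfolding conjugate_def by (rule exI[of _ 1]) (simp add: rotate_def)

lemma conjugate_sym:
  assumes "conjugate u v"
  shows "conjugate v u"
proof -
  have "conjugate (rotate n u) u" for n
  proof (cases "u = []")
    case False
    let ?l = "length u"
    have "n mod ?l \<le> ?l" using False by (simp add: less_imp_le)
    then have "rotate (?l - n mod ?l) (rotate n u) = u"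
      by (metis le_add_diff_inverse2 rotate_conv_mod rotate_id rotate_rotate mod_self)
    then show ?thesis unfolding conjugate_def by metis
  qed (simp add: conjugate_refl)
  then show ?thesis using assms by (auto simp: conjugate_def)
qed

lemma finite_conjugates: "finite {u. conjugate v u}"
proof -
  have "{u. conjugate v u} \<subseteq> {u. set u \<subseteq> set v \<and> length u = length v}"
    by (auto simp: conjugate_def)
  then show ?thesis by (rule finite_subset) (simp add: finite_lists_length_eq)
qed

lemma clustering_card_le:
  fixes rD rA :: "'a::finite rel"
  assumes "strict_linear_order rD" "strict_linear_order rA" "clustering rD rA vs"
    and prim: "\<forall>i<length vs. primitive (vs ! i)"
    and nconj: "\<forall>i<length vs. \<forall>j<length vs. i \<noteq> j \<longrightarrow> \<not> conjugate (vs ! i) (vs ! j)"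
  shows "2 * length vs \<le> CARD('a) + dim {x. Omega rD rA *v x = 0}"
proof -
  let ?n = "length vs"
  define X where "X = (\<Union>i<?n. {u. conjugate (vs ! i) u})"
  have XE: "\<exists>i<?n. conjugate (vs ! i) u" if "u \<in> X" for u using that by (auto simp: X_def)
  have rotX: "rotate1 u \<in> X" if "u \<in> X" for u
    using that conjugate_rotate1 conjugate_trans unfolding X_def by blast
  have finX: "finite X" unfolding X_def by (auto intro: finite_conjugates)
  interpret clustered_rotations rD rA X
  proof
    show "[] \<notin> X"
      using assms(3) unfolding X_def clustering_def conjugate_def
      by (auto simp: eq_commute[of "[]"])
    show "rotate1 ` X = X"
    proof (rule card_subset_eq[OF finX])
      show "card (rotate1 ` X) = card X"
        using inj_rotate1 by (meson card_image inj_on_subset subset_UNIV)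
    qed (use rotX in auto)
    show "less_A rA u v \<longleftrightarrow> less_D rD u v" if "u \<in> X" "v \<in> X" for u v
      using XE[OF that(1)] XE[OF that(2)] assms(3) by (auto simp: clustering_def)
  qed (use assms finX in auto)
  have inj: "inj_on cycle X"
    using XE prim primitive_conjugate primitive_cycle_inject by (meson inj_onI)
  \<comment> \<open>For a primitive word the vector \<open>letter_weight (e i)\<close> is its Parikh vector.\<close>
  define e where "e i u = (of_bool (conjugate (vs ! i) u) :: real)" for i u
  have conj_rot: "conjugate v (rotate1 u) \<longleftrightarrow> conjugate v u" for u v :: "'a list"
    using conjugate_rotate1 conjugate_trans conjugate_sym by meson
  have inv: "invariant (\<lambda>u. \<Sum>i<?n. c i * e i u)" "invariant (e i)" for c i
    by (auto simp: invariant_def e_def conj_rot)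
  show ?thesis
  proof (rule isotropic_family_card_le)
    show "letter_weight (e i) \<bullet> (Omega rD rA *v letter_weight (e j)) = 0" for i j
      using letter_weight_isotropic inv by blast
  next
    fix c i assume c: "(\<Sum>i<?n. c i *\<^sub>R letter_weight (e i)) = 0" and i: "i < ?n"
    have "letter_weight (\<lambda>u. \<Sum>i<?n. c i * e i u) = (\<Sum>i<?n. c i *\<^sub>R letter_weight (e i))"
      by (simp add: vec_eq_iff letter_weight_def sum_distrib_left) (rule allI, rule sum.swap)
    then have "(\<Sum>j<?n. c j * e j (vs ! i)) = 0"
      using c i by (intro weight_eq_0[OF inv(1) _ inj]) (auto simp: X_def intro: conjugate_refl)
    moreover have "c j * e j (vs ! i) = (if j = i then c i else 0)" if "j < ?n" for j
      using nconj that i by (auto simp: e_def conjugate_refl)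
    ultimately have "(\<Sum>j<?n. if j = i then c i else 0) = 0" by simp
    then show "c i = 0" using i by simp
  qed
qed

section \<open>The matrix of a pair of orders\<close>

lemma invertible_Omega_even:
  fixes rD rA :: "'a::finite rel"
  assumes "strict_linear_order rD" "strict_linear_order rA" "invertible (Omega rD rA)"
  shows "even CARD('a)"
proof (rule ccontr)
  assume odd: "odd CARD('a)"
  let ?M = "Omega rD rA"
  have skew: "?M $ j $ i = - ?M $ i $ j" for i j
    using strict_linear_order_antisym[OF assms(1), of i j]
      strict_linear_order_antisym[OF assms(2), of i j]
    by (cases "(i, j) \<in> rD"; cases "(i, j) \<in> rA"; simp add: Omega_def)
  have "transpose ?M = (\<chi> i. (- 1) *s ?M $ i)"
    by (simp add: vec_eq_iff transpose_def) (intro allI, rule skew)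
  then have "det ?M = det (\<chi> i. (- 1) *s ?M $ i)"
    using det_transpose[of ?M] by simp
  also have "\<dots> = (- 1) ^ CARD('a) * det ?M"
    by (subst det_rows_mul) simp
  finally have "det ?M = 0" using odd by simp
  then show False using assms(3) invertible_det_nz by blast
qed

text \<open>Row \<open>m\<close> of the kernel equation says that the entries above \<open>m\<close> and the entries below \<open>m\<close>
  have the same sum.\<close>

lemma symmetric_kernel_entry:
  fixes rD rA :: "'a::finite rel" and x :: "real ^ 'a"
  assumes "strict_linear_order rD" "symmetric_pair rD rA" "Omega rD rA *v x = 0"
  shows "x $ m = (\<Sum>j\<in>UNIV. x $ j) - 2 * (\<Sum>j | (j, m) \<in> rD. x $ j)"
proof -
  let ?S = "\<Sum>j\<in>UNIV. x $ j"
  note antisym = strict_linear_order_antisym[OF assms(1)]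
  have "Omega rD rA $ m $ j = 1 - of_bool (j = m) - 2 * of_bool ((j, m) \<in> rD)" for j
    using assms(1,2) antisym[of j m] antisym[of m j] antisym[of m m]
    unfolding Omega_def symmetric_pair_def strict_linear_order_on_def total_on_def by auto
  then have "(Omega rD rA *v x) $ m
      = (\<Sum>j\<in>UNIV. (1 - of_bool (j = m) - 2 * of_bool ((j, m) \<in> rD)) * x $ j)"
    by (simp add: matrix_vector_mult_def)
  also have "\<dots> = (\<Sum>j\<in>UNIV. x $ j - (if j = m then x $ j else 0)
      - 2 * (if (j, m) \<in> rD then x $ j else 0))"
    by (rule sum.cong) auto
  also have "\<dots> = ?S - x $ m - 2 * (\<Sum>j\<in>UNIV. if (j, m) \<in> rD then x $ j else 0)"
    by (simp add: sum_subtractf sum_distrib_left)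
  also have "(\<Sum>j\<in>UNIV. if (j, m) \<in> rD then x $ j else 0) = (\<Sum>j | (j, m) \<in> rD. x $ j)"
    by (simp add: sum.If_cases)
  finally show ?thesis using assms(3) by simp
qed

text \<open>By \<open>symmetric_kernel_entry\<close> the entry at \<open>m\<close> is \<open>S - 2 P\<close> for the total sum \<open>S\<close> and the
  sum \<open>P\<close> over the letters below \<open>m\<close>.  So adding \<open>m\<close> to this initial segment replaces its sum
  \<open>P\<close> by \<open>S - P\<close>, and the sums of the initial segments alternate between \<open>0\<close> and \<open>S\<close>.\<close>

lemma symmetric_kernel_prefix_sum:
  fixes rD rA :: "'a::finite rel" and x :: "real ^ 'a"
  assumes "strict_linear_order rD" "symmetric_pair rD rA" "Omega rD rA *v x = 0"
    and "\<And>a b. b \<in> Y \<Longrightarrow> (a, b) \<in> rD \<Longrightarrow> a \<in> Y"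
  shows "(\<Sum>j\<in>Y. x $ j) = (if even (card Y) then 0 else \<Sum>j\<in>UNIV. x $ j)"
proof -
  let ?S = "\<Sum>j\<in>UNIV. x $ j"
  note antisym = strict_linear_order_antisym[OF assms(1)]
  show ?thesis
    using assms(4)
  proof (induction "card Y" arbitrary: Y)
    case (Suc n)
    let ?R = "\<lambda>a b. (a, b) \<in> rD"
    have "Y \<noteq> {}" "finite Y" using Suc.hyps(2) by auto
    moreover have "asymp_on Y ?R"
      using antisym by (simp add: asymp_on_def)
    moreover have "transp_on Y ?R"
      using assms(1) unfolding strict_linear_order_on_def trans_def transp_on_def by blast
    ultimately obtain m where m: "m \<in> Y" "\<forall>y\<in>Y. y \<noteq> m \<longrightarrow> (m, y) \<notin> rD"
      using Finite_Set.bex_max_element[of Y ?R] by blast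
    have "(j, m) \<in> rD" if "j \<in> Y" "j \<noteq> m" for j
      using that m(2) assms(1) unfolding strict_linear_order_on_def total_on_def by blast
    then have below: "{j. (j, m) \<in> rD} = Y - {m}"
      using m(1) Suc.prems antisym[of m m] by blast
    have card: "card (Y - {m}) = n" using m(1) Suc.hyps(2) by simp
    have IH: "(\<Sum>j\<in>Y - {m}. x $ j) = (if even (card (Y - {m})) then 0 else ?S)"
    proof (rule Suc.hyps(1))
      show "a \<in> Y - {m}" if "b \<in> Y - {m}" "(a, b) \<in> rD" for a b
        using that Suc.prems m by blast
    qed (simp add: card)
    have "(\<Sum>j\<in>Y. x $ j) = x $ m + (\<Sum>j\<in>Y - {m}. x $ j)"
      using m(1) by (simp add: sum.remove)
    also have "\<dots> = ?S - (\<Sum>j\<in>Y - {m}. x $ j)"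
      using symmetric_kernel_entry[OF assms(1-3), of m] below by simp
    finally show ?case using IH Suc.hyps(2) card by (auto simp flip: Suc.hyps(2))
  qed auto
qed

text \<open>In the formula for a single entry, \<open>x\<^sub>m = S - 2 P\<close>, the sum \<open>P\<close> is \<open>0\<close> or \<open>S\<close>
  according to the parity of the number of letters below \<open>m\<close>.\<close>

lemma symmetric_kernel_alternating:
  fixes rD rA :: "'a::finite rel" and x :: "real ^ 'a"
  assumes "strict_linear_order rD" "symmetric_pair rD rA" "Omega rD rA *v x = 0"
  shows "x = (\<Sum>j\<in>UNIV. x $ j) *\<^sub>R (\<chi> m. if even (card {j. (j, m) \<in> rD}) then 1 else - 1)"
proof -
  have "x $ m = (\<Sum>j\<in>UNIV. x $ j) * (if even (card {j. (j, m) \<in> rD}) then 1 else - 1)" for m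
  proof -
    have "a \<in> {j. (j, m) \<in> rD}" if "b \<in> {j. (j, m) \<in> rD}" "(a, b) \<in> rD" for a b
      using that assms(1) unfolding strict_linear_order_on_def trans_def by blast
    then have "(\<Sum>j | (j, m) \<in> rD. x $ j)
        = (if even (card {j. (j, m) \<in> rD}) then 0 else \<Sum>j\<in>UNIV. x $ j)"
      by (rule symmetric_kernel_prefix_sum[OF assms])
    then show ?thesis using symmetric_kernel_entry[OF assms, of m] by simp
  qed
  then show ?thesis
    unfolding vec_eq_iff vector_scaleR_component vec_lambda_beta real_scaleR_def by blast
qed

lemma symmetric_kernel_dim_le:
  fixes rD rA :: "'a::finite rel"
  assumes "strict_linear_order rD" "symmetric_pair rD rA"
  shows "dim {x. Omega rD rA *v x = 0} \<le> 1"
proof -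
  let ?s = "(\<chi> m. if even (card {j. (j, m) \<in> rD}) then 1 else - 1) :: real ^ 'a"
  have "{x. Omega rD rA *v x = 0} \<subseteq> span {?s}"
    using symmetric_kernel_alternating[OF assms] unfolding span_singleton by blast
  then have "dim {x. Omega rD rA *v x = 0} \<le> card {?s}"
    by (rule dim_le_card) simp
  then show ?thesis by simp
qed

lemma symmetric_Omega_invertible:
  fixes rD rA :: "'a::finite rel"
  assumes "strict_linear_order rD" "symmetric_pair rD rA" "even CARD('a)"
  shows "invertible (Omega rD rA)"
proof -
  have "x = 0" if x: "Omega rD rA *v x = 0" for x
  proof -
    have "(\<Sum>j\<in>UNIV. x $ j) = 0"
      using symmetric_kernel_prefix_sum[OF assms(1,2) x, of UNIV] assms(3) by simp
    then show ?thesis using symmetric_kernel_alternating[OF assms(1,2) x] by simp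
  qed
  then show ?thesis
    unfolding invertible_left_inverse by (subst matrix_left_invertible_ker) blast
qed

section \<open>The cardinality of clustering families\<close>

theorem corollary1:
  fixes rD rA :: "'a::finite rel"
    and vs :: "'a list list"
    and k d n :: nat
  assumes "k = CARD('a)"
    and "strict_linear_order rD" and "strict_linear_order rA" and "rD \<noteq> rA"
    and "d = dim {x :: real ^ 'a. Omega rD rA *v x = 0}"
    and "n = length vs"
    and "\<forall>i<n. primitive (vs ! i)"
    and "\<forall>i<n. \<forall>j<n. i \<noteq> j \<longrightarrow> \<not> conjugate (vs ! i) (vs ! j)"
  shows "(clustering rD rA vs \<longrightarrow> n \<le> (k + d) div 2)
       \<and> (invertible (Omega rD rA) \<longrightarrow>
            even k \<and> (clustering rD rA vs \<longrightarrow> real n \<le> real k / 2))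
       \<and> (symmetric_pair rD rA \<longrightarrow> (invertible (Omega rD rA) \<longleftrightarrow> even k))
       \<and> (perfectly_clustering vs \<longrightarrow> n \<le> (k + 1) div 2)"
proof (intro conjI impI)
  have bound: "2 * n \<le> k + dim {x. Omega r s *v x = 0}"
    if "strict_linear_order r" "strict_linear_order s" "clustering r s vs" for r s :: "'a rel"
    using clustering_card_le[OF that] assms(1,6-8) by simp
  show "n \<le> (k + d) div 2" if "clustering rD rA vs"
    using bound[OF assms(2,3) that] assms(5) by simp
  show "even k" if "invertible (Omega rD rA)"
    using invertible_Omega_even assms(1-3) that by blast
  show "real n \<le> real k / 2" if inv: "invertible (Omega rD rA)" and cl: "clustering rD rA vs"
  proof -
    have "{x. Omega rD rA *v x = 0} = {0}"
      using inv unfolding invertible_left_inverse matrix_left_invertible_ker by auto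
    then have "2 * n \<le> k" using bound[OF assms(2,3) cl] by simp
    then show ?thesis by simp
  qed
  show "invertible (Omega rD rA) \<longleftrightarrow> even k" if "symmetric_pair rD rA"
    using symmetric_Omega_invertible invertible_Omega_even assms(1-3) that by blast
  show "n \<le> (k + 1) div 2" if "perfectly_clustering vs"
  proof -
    obtain r s :: "'a rel" where rs: "strict_linear_order r" "strict_linear_order s"
      "symmetric_pair r s" "clustering r s vs"
      using \<open>perfectly_clustering vs\<close> by (auto simp: perfectly_clustering_def)
    show ?thesis using bound[OF rs(1,2,4)] symmetric_kernel_dim_le[OF rs(1,3)] by simp
  qed
qed

end
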